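(* Let $f:\mathbb{R}^2\to\mathbb{R}^2$ be $C^1$ with equilibrium $x_\ast$ such that $f'(x_\ast)=\begin{pmatrix}\lambda&-\omega\\ \omega&\lambda\end{pmatrix}$ with $\lambda>0$, $\omega>0$. Let $K=\begin{pmatrix}\alpha&-\beta\\ \beta&\alpha\end{pmatrix}$ with $\alpha,\beta\in\mathbb{R}$. Then for every positive integer $n$, the characteristic equation $\det(z I-f'(x_\ast)-K[1-e^{-zT}])=0$ with $T=2\pi n/\omega$ has a root with positive real part; in particular $x_\ast$ is unstable as a solution of $\dot x(t)=f(x(t))+K\big[x(t)-x(t-\tfrac{2\pi n}{\omega})\big]$. *)

theory Defs
  imports "HOL-Analysis.Analysis"
begin

definition rotmat :: "real \<Rightarrow> real \<Rightarrow> real^2^2" where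
  "rotmat a b = vector [vector [a, -b], vector [b, a]]"

definition cmat :: "real^'n^'m \<Rightarrow> complex^'n^'m" where
  "cmat M = (\<chi> i j. complex_of_real (M $ i $ j))"

definition char_fun :: "real^2^2 \<Rightarrow> real^2^2 \<Rightarrow> real \<Rightarrow> complex \<Rightarrow> complex" where
  "char_fun A K T z = det (mat z - cmat A - mat (1 - exp (- z * complex_of_real T)) ** cmat K)"

end

theory Submission
  imports Defs "HOL-Real_Asymp.Real_Asymp"
begin

text \<open>
  Put \<open>z = u / T - \<i> \<omega>\<close>. Since \<open>\<omega> T = 2 \<pi> n\<close>, \<open>exp (- z T) = exp (- u)\<close>, and as both
  matrices are of the form \<open>a I + b J\<close> with \<open>J\<close> the rotation by \<open>\<pi>/2\<close>, the characteristic
  function is a sum of two squares, which vanishes once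
  \<open>u = \<lambda> T + T (\<alpha> - \<i> \<beta>) (1 - exp (- u))\<close>. So it suffices to solve
  \<open>u = a + b (1 - exp (- u))\<close> with \<open>Re u > 0\<close> for every \<open>a > 0\<close> and complex \<open>b\<close>.

  For \<open>b = r exp (\<i> \<phi>)\<close> and \<open>u = x + \<i> (t + \<phi>)\<close> this is Kepler's equation
  \<open>t - e sin t = \<eta>\<close> with eccentricity \<open>e = r exp (- x)\<close>, coupled with \<open>x + e cos t = v\<close>,
  where \<open>\<eta> = \<theta> - r sin \<theta>\<close> and \<open>v = r cos \<theta> + a\<close> for \<open>\<theta> = - \<phi>\<close>; we need \<open>0 < e < r\<close>.
  Along the curve \<open>e = (t - \<eta>) / sin t\<close> the second equation becomes a scalar equation in
  \<open>t\<close>. Its left-hand side tends to \<open>+\<infinity>\<close> (or to \<open>ln r + 1\<close> when \<open>\<eta>\<close> is a multiple of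
  \<open>2 \<pi>\<close>) as \<open>t\<close> approaches \<open>\<eta>\<close>, and equals \<open>r cos t\<close> at the zeros of
  \<open>t - r sin t - \<eta>\<close>, where \<open>e = r\<close>. The intermediate value theorem between suitable
  consecutive such zeros gives the solution: \<open>a > 0\<close> enters as \<open>r cos \<theta> < v\<close> at the zero
  \<open>\<theta>\<close>, and the sign of the slope \<open>1 - r cos t\<close> at the other zeros is read off from the
  side on which \<open>t - r sin t - \<eta>\<close> is negative.
\<close>

section \<open>Zeros and one-sided signs of real functions\<close>

lemma sin_less_self:
  fixes x :: real
  assumes "0 < x"
  shows "sin x < x"
proof (cases "x < pi")
  case True
  have "cos (x / 2) < cos 0" using assms True by (intro cos_monotone_0_pi) auto
  moreover have "0 < sin (x / 2)" using assms True by (intro sin_gt_zero) auto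
  ultimately have "sin x < 2 * sin (x / 2)"
    using sin_double[of "x / 2"] by simp
  also have "\<dots> \<le> x" using sin_x_le_x[of "x / 2"] assms by simp
  finally show ?thesis .
next
  case False
  then show ?thesis using sin_le_one[of x] pi_gt3 by linarith
qed

lemma eventually_less_at_left_if_deriv_pos:
  fixes f :: "real \<Rightarrow> real"
  assumes "(f has_real_derivative D) (at x)" "0 < D"
  shows "eventually (\<lambda>y. f y < f x) (at_left x)"
proof -
  obtain d where "0 < d" "\<forall>h>0. h < d \<longrightarrow> f (x - h) < f x"
    using DERIV_pos_inc_left[OF assms] by blast
  then show ?thesis
    unfolding eventually_at_left_field by (intro exI[of _ "x - d"]) (auto dest: spec[of _ "x - _"])
qed

lemma eventually_less_at_right_if_deriv_neg:
  fixes f :: "real \<Rightarrow> real"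
  assumes "(f has_real_derivative D) (at x)" "D < 0"
  shows "eventually (\<lambda>y. f y < f x) (at_right x)"
proof -
  obtain d where "0 < d" "\<forall>h>0. h < d \<longrightarrow> f (x + h) < f x"
    using DERIV_neg_dec_right[OF assms] by blast
  then show ?thesis
    unfolding eventually_at_right_field by (intro exI[of _ "x + d"]) (auto dest: spec[of _ "_ - x"])
qed

lemma deriv_nonpos_if_eventually_less_at_right:
  fixes f :: "real \<Rightarrow> real"
  assumes der: "(f has_real_derivative D) (at x)" and less: "eventually (\<lambda>y. f y < f x) (at_right x)"
  shows "D \<le> 0"
proof (rule ccontr)
  assume "\<not> D \<le> 0"
  then have "eventually (\<lambda>y. - f y < - f x) (at_right x)"
    using der by (intro eventually_less_at_right_if_deriv_neg[of _ "- D"]) (auto intro: DERIV_minus)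
  with less have "eventually (\<lambda>_. False) (at_right x)"
    by eventually_elim auto
  then show False by simp
qed

lemma first_zero_after:
  fixes g :: "real \<Rightarrow> real"
  assumes cont: "continuous_on {a..b} g" and "a < b"
    and neg: "eventually (\<lambda>s. g s < 0) (at_right a)" and "0 \<le> g b"
  shows "\<exists>c\<in>{a<..b}. g c = 0 \<and> (\<forall>s\<in>{a<..<c}. g s < 0)"
proof -
  obtain m where m: "a < m" "m < b" "\<And>s. a < s \<Longrightarrow> s \<le> m \<Longrightarrow> g s < 0"
  proof -
    obtain d where "a < d" "\<And>s. a < s \<Longrightarrow> s < d \<Longrightarrow> g s < 0"
      using neg unfolding eventually_at_right_field by blast
    then show ?thesis
      using \<open>a < b\<close> by (intro that[of "(a + min d b) / 2"]) auto
  qed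
  let ?S = "{s \<in> {m..b}. 0 \<le> g s}"
  have cont_m: "continuous_on {m..b} g"
    using m by (intro continuous_on_subset[OF cont]) auto
  have "compact ?S"
    unfolding compact_eq_bounded_closed
    using continuous_on_closed_Collect_le[OF continuous_on_const cont_m]
    by (auto intro: bounded_subset[OF bounded_closed_interval])
  moreover have "b \<in> ?S" using m \<open>0 \<le> g b\<close> by auto
  ultimately obtain c where c: "c \<in> ?S" and least: "\<And>s. s \<in> ?S \<Longrightarrow> c \<le> s"
    using compact_attains_inf[of ?S] by blast
  have "m < c" using c m(1) m(3)[of m] by (cases "c = m") auto
  have "g c = 0"
  proof (rule ccontr)
    assume "g c \<noteq> 0"
    with c have "0 < g c" by simp
    moreover have "continuous_on {m..c} g"
      using c by (intro continuous_on_subset[OF cont_m]) auto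
    ultimately obtain s where "m \<le> s" "s \<le> c" "g s = 0"
      using IVT'[of g m 0 c] m(1) m(3)[of m] \<open>m < c\<close> by auto
    moreover from this have "c \<le> s" using c by (intro least) auto
    ultimately show False using \<open>g c \<noteq> 0\<close> by auto
  qed
  moreover have "g s < 0" if "a < s" "s < c" for s
  proof (cases "s \<le> m")
    case False
    then have "s \<notin> ?S" using least[of s] that by auto
    then show ?thesis using False that c by auto
  qed (use m that in auto)
  ultimately show ?thesis using c m by auto
qed

lemma last_zero_before:
  fixes g :: "real \<Rightarrow> real"
  assumes cont: "continuous_on {a..b} g" and "a < b"
    and "0 \<le> g a" and neg: "eventually (\<lambda>s. g s < 0) (at_left b)"
  shows "\<exists>c\<in>{a..<b}. g c = 0 \<and> (\<forall>s\<in>{c<..<b}. g s < 0)"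
proof -
  have "continuous_on {- b..- a} (\<lambda>s. g (- s))"
    using cont by (intro continuous_on_compose2[OF cont]) (auto intro: continuous_intros)
  moreover have "eventually (\<lambda>s. g (- s) < 0) (at_right (- b))"
    using neg unfolding eventually_at_left_field eventually_at_right_field
    by (metis minus_less_iff neg_less_iff_less)
  ultimately obtain c where c: "c \<in> {- b<..- a}" "g (- c) = 0" and neg_c: "\<forall>s\<in>{- b<..<c}. g (- s) < 0"
    using first_zero_after[of "- b" "- a" "\<lambda>s. g (- s)"] assms by auto
  show ?thesis
  proof (intro bexI[of _ "- c"] conjI ballI)
    fix s assume "s \<in> {- c<..<b}"
    then show "g s < 0" using neg_c[rule_format, of "- s"] by auto
  qed (use c in auto)
qed

section \<open>Kepler's equation\<close>

definition kepler :: "real \<Rightarrow> real \<Rightarrow> real" where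
  "kepler e t = t - e * sin t"

lemma kepler_has_real_derivative: "(kepler e has_real_derivative 1 - e * cos t) (at t)"
  unfolding kepler_def[abs_def] by (auto intro!: derivative_eq_intros)

lemma continuous_on_kepler: "continuous_on S (kepler e)"
  unfolding kepler_def[abs_def] by (intro continuous_intros)

lemma kepler_minus: "kepler e (- t) = - kepler e t"
  by (simp add: kepler_def)

lemma kepler_slope_at_upcrossing:
  assumes curv: "0 < r * sin t" and below: "eventually (\<lambda>s. kepler r s < kepler r t) (at_left t)"
  shows "r * cos t < 1"
proof (rule ccontr)
  assume "\<not> r * cos t < 1"
  have "eventually (\<lambda>s. 1 - r * cos s < 0) (at_left t)"
  proof (cases "r * cos t = 1")
    case True
    have "((\<lambda>s. 1 - r * cos s) has_real_derivative r * sin t) (at t)"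
      by (auto intro!: derivative_eq_intros)
    from eventually_less_at_left_if_deriv_pos[OF this curv] show ?thesis using True by simp
  next
    case False
    then have "1 - r * cos t < 0" using \<open>\<not> r * cos t < 1\<close> by simp
    moreover have "((\<lambda>s. 1 - r * cos s) \<longlongrightarrow> 1 - r * cos t) (at_left t)"
      by (intro tendsto_intros)
    ultimately show ?thesis using order_tendstoD(2) by blast
  qed
  then obtain b where "b < t" and decr: "\<And>\<xi>. b < \<xi> \<Longrightarrow> \<xi> < t \<Longrightarrow> 1 - r * cos \<xi> < 0"
    unfolding eventually_at_left_field by blast
  have "kepler r t < kepler r s" if s: "b < s" "s < t" for s
  proof -
    obtain \<xi> where "s < \<xi>" "\<xi> < t" "kepler r t - kepler r s = (t - s) * (1 - r * cos \<xi>)"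
      using MVT2[OF \<open>s < t\<close> kepler_has_real_derivative] by blast
    moreover have "(t - s) * (1 - r * cos \<xi>) < 0"
      using decr[of \<xi>] s \<open>s < \<xi>\<close> \<open>\<xi> < t\<close> by (intro mult_pos_neg) auto
    ultimately show ?thesis by simp
  qed
  then have "eventually (\<lambda>s. kepler r t < kepler r s) (at_left t)"
    unfolding eventually_at_left_field using \<open>b < t\<close> by blast
  with below have "eventually (\<lambda>_. False) (at_left t)"
    by eventually_elim auto
  then show False by simp
qed

lemma kepler_first_upcrossing:
  assumes "\<eta> < b" "\<eta> \<le> kepler r b"
    and below: "eventually (\<lambda>t. kepler r t < \<eta>) (at_right \<eta>)"
  shows "\<exists>te\<in>{\<eta><..b}. kepler r te = \<eta> \<and> (\<forall>t\<in>{\<eta><..<te}. kepler r t < \<eta>) \<and> r * cos te < 1"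
proof -
  obtain te where te: "te \<in> {\<eta><..b}" "kepler r te - \<eta> = 0"
    and inside: "\<forall>t\<in>{\<eta><..<te}. kepler r t - \<eta> < 0"
    using first_zero_after[of \<eta> b "\<lambda>t. kepler r t - \<eta>"] assms
      continuous_on_diff[OF continuous_on_kepler continuous_on_const]
    by auto
  have "r * cos te < 1"
  proof (rule kepler_slope_at_upcrossing)
    show "0 < r * sin te" using te by (simp add: kepler_def)
    show "eventually (\<lambda>s. kepler r s < kepler r te) (at_left te)"
      using eventually_at_left_real[of \<eta> te] te inside by (auto elim!: eventually_mono)
  qed
  then show ?thesis using te inside by auto
qed

section \<open>A real form of the equation \<open>u = a + b (1 - exp (- u))\<close>\<close>

text \<open>
  For \<open>r = cmod b\<close>, a solution \<open>(x, t)\<close> gives the solution \<open>u = x + \<i> (t + Arg b)\<close> of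
  \<open>u = a + b (1 - exp (- u))\<close> with \<open>\<eta> = r sin (Arg b) - Arg b\<close> and \<open>v = a + r cos (Arg b)\<close>.
\<close>

definition kepler_root :: "real \<Rightarrow> real \<Rightarrow> real \<Rightarrow> bool" where
  "kepler_root r \<eta> v \<longleftrightarrow> (\<exists>x>0. \<exists>t. kepler (r * exp (- x)) t = \<eta> \<and> x + r * exp (- x) * cos t = v)"

lemma kepler_root_minus: "kepler_root r (- \<eta>) v \<longleftrightarrow> kepler_root r \<eta> v"
proof -
  have "kepler_root r (- \<eta>) v" if "kepler_root r \<eta> v" for \<eta>
  proof -
    from that obtain x t where "0 < x" "kepler (r * exp (- x)) t = \<eta>" "x + r * exp (- x) * cos t = v"
      unfolding kepler_root_def by blast
    then show ?thesis
      unfolding kepler_root_def by (intro exI[of _ x] conjI exI[of _ "- t"]) (auto simp: kepler_minus)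
  qed
  from this[of \<eta>] this[of "- \<eta>"] show ?thesis by auto
qed

lemma kepler_root_at_rest:
  assumes sin: "sin \<eta> = 0" and "0 \<le> x0" and start: "x0 + r * exp (- x0) * cos \<eta> \<le> v"
    and "x0 + r * exp (- x0) * cos \<eta> = v \<Longrightarrow> 0 < x0"
  shows "kepler_root r \<eta> v"
proof -
  define X where "X = \<bar>x0\<bar> + \<bar>v\<bar> + \<bar>r\<bar> + 1"
  have "\<bar>r * exp (- X) * cos \<eta>\<bar> \<le> \<bar>r\<bar> * 1 * 1"
    unfolding abs_mult by (intro mult_mono) (auto simp: X_def)
  moreover have "v + \<bar>r\<bar> < X" by (simp add: X_def)
  ultimately have "v \<le> X + r * exp (- X) * cos \<eta>" by (simp add: abs_le_iff)
  moreover have "continuous_on {x0..X} (\<lambda>x. x + r * exp (- x) * cos \<eta>)"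
    by (intro continuous_intros)
  ultimately obtain x where x: "x0 \<le> x" "x + r * exp (- x) * cos \<eta> = v"
    using IVT'[of "\<lambda>x. x + r * exp (- x) * cos \<eta>" x0 v X] start by (force simp: X_def)
  moreover have "0 < x" using x assms by (cases "x = x0") auto
  ultimately show ?thesis
    unfolding kepler_root_def using sin by (intro exI[of _ x] conjI exI[of _ \<eta>]) (auto simp: kepler_def)
qed

text \<open>
  \<open>kepler_ecc \<eta> t\<close> is the eccentricity \<open>e\<close> with \<open>kepler e t = \<eta>\<close> (and \<open>0\<close> where \<open>sin t = 0\<close>);
  \<open>kepler_level r \<eta> t\<close> is \<open>x + r exp (- x) cos t\<close> for the \<open>x\<close> with \<open>r exp (- x) = e\<close>.
\<close>

definition kepler_ecc :: "real \<Rightarrow> real \<Rightarrow> real" where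
  "kepler_ecc \<eta> t = (t - \<eta>) / sin t"

definition kepler_level :: "real \<Rightarrow> real \<Rightarrow> real \<Rightarrow> real" where
  "kepler_level r \<eta> t = ln (r / kepler_ecc \<eta> t) + kepler_ecc \<eta> t * cos t"

lemma kepler_root_if_level:
  assumes pos: "0 < kepler_ecc \<eta> t" and less: "kepler_ecc \<eta> t < r"
    and level: "kepler_level r \<eta> t = v"
  shows "kepler_root r \<eta> v"
  unfolding kepler_root_def
proof (intro exI conjI)
  define e where "e = kepler_ecc \<eta> t"
  have "sin t \<noteq> 0" using pos by (auto simp: kepler_ecc_def)
  moreover have e_r: "r * exp (- ln (r / e)) = e"
    using pos less by (simp add: e_def exp_minus)
  ultimately show "kepler (r * exp (- ln (r / e))) t = \<eta>"
    by (simp add: kepler_def e_def kepler_ecc_def)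
  show "ln (r / e) + r * exp (- ln (r / e)) * cos t = v"
    using level e_r by (simp add: kepler_level_def e_def)
  show "0 < ln (r / e)"
    using pos less by (simp add: e_def)
qed

lemma kepler_level_eq_cos:
  assumes "0 < r" "kepler r t = \<eta>" "t \<noteq> \<eta>"
  shows "kepler_level r \<eta> t = r * cos t"
proof -
  have "t - \<eta> = r * sin t" using assms(2) by (simp add: kepler_def)
  moreover have "sin t \<noteq> 0" using calculation assms(3) by auto
  ultimately have "kepler_ecc \<eta> t = r" using assms by (simp add: kepler_ecc_def)
  then show ?thesis using assms(1) by (simp add: kepler_level_def)
qed

lemma kepler_root_by_IVT:
  assumes r: "0 < r" and "p \<le> s"
    and between: "\<And>t. p \<le> t \<Longrightarrow> t \<le> s \<Longrightarrow> \<eta> < t \<and> kepler r t \<le> \<eta>"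
    and ends: "kepler_level r \<eta> s \<le> v" "v \<le> kepler_level r \<eta> p"
    and off_level: "\<And>t. p \<le> t \<Longrightarrow> t \<le> s \<Longrightarrow> kepler r t = \<eta> \<Longrightarrow> r * cos t \<noteq> v"
  shows "kepler_root r \<eta> v"
proof -
  have ecc: "0 < kepler_ecc \<eta> t \<and> kepler_ecc \<eta> t \<le> r" "0 < sin t"
    if "p \<le> t" "t \<le> s" for t
  proof -
    have "0 < t - \<eta>" "t - \<eta> \<le> r * sin t"
      using between[OF that] by (auto simp: kepler_def)
    then have "0 < r * sin t" by linarith
    then show "0 < sin t" using r by (simp add: zero_less_mult_iff)
    with \<open>0 < t - \<eta>\<close> \<open>t - \<eta> \<le> r * sin t\<close>
    show "0 < kepler_ecc \<eta> t \<and> kepler_ecc \<eta> t \<le> r"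
      by (simp add: kepler_ecc_def pos_divide_le_eq)
  qed
  have "sin t \<noteq> 0 \<and> (t - \<eta>) / sin t \<noteq> 0 \<and> r / ((t - \<eta>) / sin t) \<noteq> 0"
    if "t \<in> {p..s}" for t
    using ecc[of t] r that by (auto simp: kepler_ecc_def)
  then have "continuous_on {p..s} (kepler_level r \<eta>)"
    unfolding kepler_level_def[abs_def] kepler_ecc_def[abs_def] by (intro continuous_intros) auto
  then obtain t where t: "p \<le> t" "t \<le> s" "kepler_level r \<eta> t = v"
    using IVT2'[of "kepler_level r \<eta>" s v p] ends \<open>p \<le> s\<close> by blast
  have "kepler r t \<noteq> \<eta>"
    using off_level[OF t(1,2)] kepler_level_eq_cos[OF r] between[OF t(1,2)] t(3) by force
  then have "kepler_ecc \<eta> t < r"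
    using between[OF t(1,2)] ecc[OF t(1,2)] by (auto simp: kepler_ecc_def kepler_def divide_less_eq)
  then show ?thesis using kepler_root_if_level ecc[OF t(1,2)] t(3) by blast
qed

lemma filterlim_kepler_level_at_top:
  assumes r: "0 < r" and sin: "0 < sin \<eta>"
  shows "filterlim (kepler_level r \<eta>) at_top (at_right \<eta>)"
proof -
  have "((\<lambda>t. (t - \<eta>) / sin t) \<longlongrightarrow> (\<eta> - \<eta>) / sin \<eta>) (at_right \<eta>)"
    using sin by (intro tendsto_intros) auto
  moreover have "eventually (\<lambda>t. 0 < sin t) (at_right \<eta>)"
    using sin by (intro order_tendstoD(1)[of _ "sin \<eta>"] tendsto_intros) auto
  then have "eventually (\<lambda>t. 0 < (t - \<eta>) / sin t) (at_right \<eta>)"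
    using eventually_at_right_less[of \<eta>] by eventually_elim auto
  ultimately have ecc: "filterlim (kepler_ecc \<eta>) (at_right 0) (at_right \<eta>)"
    unfolding kepler_ecc_def[abs_def] by (intro tendsto_imp_filterlim_at_right) auto
  then have "filterlim (\<lambda>t. - ln (kepler_ecc \<eta> t)) at_top (at_right \<eta>)"
    using filterlim_compose[OF ln_at_0 ecc] by (simp add: filterlim_uminus_at_bot)
  moreover have "((\<lambda>t. ln r + kepler_ecc \<eta> t * cos t) \<longlongrightarrow> ln r + 0 * cos \<eta>) (at_right \<eta>)"
    using ecc by (intro tendsto_intros) (auto simp: filterlim_at)
  ultimately have lim: "filterlim (\<lambda>t. (ln r + kepler_ecc \<eta> t * cos t) + - ln (kepler_ecc \<eta> t)) at_top (at_right \<eta>)"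
    by (intro filterlim_tendsto_add_at_top)
  have "eventually (\<lambda>t. kepler_ecc \<eta> t \<in> {0<..} \<and> kepler_ecc \<eta> t \<noteq> 0) (at_right \<eta>)"
    using ecc unfolding filterlim_at by (rule conjunct1)
  then have eq: "eventually (\<lambda>t. (ln r + kepler_ecc \<eta> t * cos t) + - ln (kepler_ecc \<eta> t) = kepler_level r \<eta> t) (at_right \<eta>)"
    by (rule eventually_mono) (use r in \<open>simp add: kepler_level_def ln_div\<close>)
  from lim show ?thesis by (rule filterlim_cong[OF refl refl eq, THEN iffD1])
qed

lemma tendsto_kepler_level_at_2pi:
  assumes r: "0 < r" and "sin \<eta> = 0" "cos \<eta> = 1"
  shows "(kepler_level r \<eta> \<longlongrightarrow> ln r + 1) (at_right \<eta>)"
proof -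
  have shift: "kepler_ecc \<eta> (y + \<eta>) = y / sin y" for y
    using assms by (simp add: kepler_ecc_def sin_add)
  have "((\<lambda>y::real. y / sin y) \<longlongrightarrow> 1) (at_right 0)"
    by real_asymp
  then have "(kepler_ecc \<eta> \<longlongrightarrow> 1) (at_right \<eta>)"
    unfolding filterlim_at_right_to_0[where a = \<eta>] shift .
  then have "(kepler_level r \<eta> \<longlongrightarrow> ln (r / 1) + 1 * cos \<eta>) (at_right \<eta>)"
    unfolding kepler_level_def[abs_def] using r by (intro tendsto_intros) auto
  then show ?thesis using assms by simp
qed

lemma kepler_root_before_first_upcrossing:
  assumes r: "0 < r" and level: "eventually (\<lambda>t. v \<le> kepler_level r \<eta> t) (at_right \<eta>)"
    and te: "\<eta> < te" "kepler r te = \<eta>" and inside: "\<forall>t\<in>{\<eta><..<te}. kepler r t < \<eta>"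
    and "r * cos te < v"
  shows "kepler_root r \<eta> v"
proof -
  obtain t1 where t1: "\<eta> < t1" "t1 < te" "v \<le> kepler_level r \<eta> t1"
    using eventually_happens'[OF _ eventually_conj[OF level eventually_at_right_real[OF te(1)]]] by auto
  show ?thesis
  proof (rule kepler_root_by_IVT[OF r, of t1 te])
    show "kepler_level r \<eta> te \<le> v"
      using kepler_level_eq_cos[OF r te(2)] te(1) \<open>r * cos te < v\<close> by simp
    show "r * cos t \<noteq> v" if "t1 \<le> t" "t \<le> te" "kepler r t = \<eta>" for t
      using that inside t1 \<open>r * cos te < v\<close> by (cases "t = te") auto
    show "\<eta> < t \<and> kepler r t \<le> \<eta>" if "t1 \<le> t" "t \<le> te" for t
    proof (cases "t = te")
      case False
      then have "t \<in> {\<eta><..<te}" using that t1 by auto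
      then show ?thesis using inside by fastforce
    qed (use te in auto)
  qed (use t1 in auto)
qed

lemma kepler_root_before_crossing:
  assumes r: "0 < r" and q: "\<eta> \<le> q" "\<eta> \<le> kepler r q" "\<eta> < q \<or> \<eta> < kepler r q"
    and "q < \<theta>" and \<theta>: "kepler r \<theta> = \<eta>" and v: "r * cos \<theta> < v" "v < 1"
  shows "kepler_root r \<eta> v"
proof -
  have "eventually (\<lambda>t. kepler r t - \<eta> < 0) (at_left \<theta>)"
    using eventually_less_at_left_if_deriv_pos[OF kepler_has_real_derivative, of r \<theta>] v \<theta> by simp
  then obtain p where p: "p \<in> {q..<\<theta>}" "kepler r p = \<eta>"
    and inside: "\<forall>t\<in>{p<..<\<theta>}. kepler r t - \<eta> < 0"
    using last_zero_before[of q \<theta> "\<lambda>t. kepler r t - \<eta>"] q \<open>q < \<theta>\<close>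
      continuous_on_diff[OF continuous_on_kepler continuous_on_const]
    by auto
  have "\<eta> < p" using p q by (cases "p = q") auto
  have "1 - r * cos p \<le> 0"
  proof (rule deriv_nonpos_if_eventually_less_at_right[OF kepler_has_real_derivative])
    show "eventually (\<lambda>t. kepler r t < kepler r p) (at_right p)"
      using eventually_at_right_real[of p \<theta>] p inside by (auto elim!: eventually_mono)
  qed
  show ?thesis
  proof (rule kepler_root_by_IVT[OF r, of p \<theta>])
    show "kepler_level r \<eta> \<theta> \<le> v"
      using kepler_level_eq_cos[OF r \<theta>] p(1) \<open>\<eta> < p\<close> v by auto
    show "v \<le> kepler_level r \<eta> p"
      using kepler_level_eq_cos[OF r p(2)] \<open>\<eta> < p\<close> v \<open>1 - r * cos p \<le> 0\<close> by auto
    show "r * cos t \<noteq> v" if "p \<le> t" "t \<le> \<theta>" "kepler r t = \<eta>" for t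
      using that inside v \<open>1 - r * cos p \<le> 0\<close> by (cases "t = p"; cases "t = \<theta>") auto
    show "\<eta> < t \<and> kepler r t \<le> \<eta>" if "p \<le> t" "t \<le> \<theta>" for t
    proof (cases "t = p \<or> t = \<theta>")
      case False
      then have "t \<in> {p<..<\<theta>}" using that by auto
      then show ?thesis using inside \<open>\<eta> < p\<close> by fastforce
    qed (use p \<theta> \<open>\<eta> < p\<close> in auto)
  qed (use p in auto)
qed

lemma kepler_root_crossing_right:
  assumes r: "0 < r"
    and below: "eventually (\<lambda>t. kepler r t < \<eta>) (at_right \<eta>)"
    and level: "eventually (\<lambda>t. v \<le> kepler_level r \<eta> t) (at_right \<eta>)"
    and "\<eta> < \<theta>" "kepler r \<theta> = \<eta>" "r * cos \<theta> < v"
  shows "kepler_root r \<eta> v"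
proof -
  obtain te where te: "te \<in> {\<eta><..\<theta>}" "kepler r te = \<eta>" "\<forall>t\<in>{\<eta><..<te}. kepler r t < \<eta>"
    "r * cos te < 1"
    using kepler_first_upcrossing[of \<eta> \<theta> r] assms by auto
  show ?thesis
  proof (cases "r * cos te < v")
    case True
    then show ?thesis using kepler_root_before_first_upcrossing[OF r level] te by auto
  next
    case False
    then have "te < \<theta>" using te \<open>r * cos \<theta> < v\<close> by (cases "te = \<theta>") auto
    then show ?thesis using kepler_root_before_crossing[OF r, of \<eta> te \<theta> v] te assms False by auto
  qed
qed

lemma kepler_root_sin_pos:
  assumes r: "0 < r" and sin: "0 < sin \<eta>" and \<theta>: "kepler r \<theta> = \<eta>" "r * cos \<theta> < v"
  shows "kepler_root r \<eta> v"
proof -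
  have "(kepler r \<longlongrightarrow> kepler r \<eta>) (at_right \<eta>)"
    unfolding kepler_def[abs_def] by (intro tendsto_intros)
  moreover have "kepler r \<eta> < \<eta>" using r sin by (simp add: kepler_def)
  ultimately have below: "eventually (\<lambda>t. kepler r t < \<eta>) (at_right \<eta>)"
    by (rule order_tendstoD(2))
  have level: "eventually (\<lambda>t. v \<le> kepler_level r \<eta> t) (at_right \<eta>)"
    using filterlim_kepler_level_at_top[OF r sin] by (simp add: filterlim_at_top)
  have "\<theta> \<noteq> \<eta>" using \<theta> sin r by (auto simp: kepler_def)
  then consider "\<eta> < \<theta>" | "\<theta> < \<eta>" by linarith
  then show ?thesis
  proof cases
    case 1
    then show ?thesis using kepler_root_crossing_right[OF r below level] \<theta> by blast
  next
    case 2
    have "r * sin (\<eta> + r + 1) \<le> r" using r by simp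
    then have "\<eta> \<le> kepler r (\<eta> + r + 1)" by (simp add: kepler_def)
    then obtain te where te: "\<eta> < te" "kepler r te = \<eta>" "\<forall>t\<in>{\<eta><..<te}. kepler r t < \<eta>"
      "r * cos te < 1"
      using kepler_first_upcrossing[of \<eta> "\<eta> + r + 1" r] below r by auto
    show ?thesis
    proof (cases "r * cos te < v")
      case True
      then show ?thesis using kepler_root_before_first_upcrossing[OF r level te(1-3)] by blast
    next
      case False
      have "kepler_root r (- \<eta>) v"
        by (rule kepler_root_before_crossing[OF r, of "- \<eta>" "- \<eta>" "- \<theta>"])
          (use r sin \<theta> 2 False te(4) in \<open>auto simp: kepler_minus kepler_def\<close>)
      then show ?thesis by (simp add: kepler_root_minus)
    qed
  qed
qed

lemma kepler_root_sin_zero: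
  assumes r: "0 < r" and sin: "sin \<eta> = 0" and "\<eta> \<le> \<theta>"
    and \<theta>: "kepler r \<theta> = \<eta>" "r * cos \<theta> < v"
  shows "kepler_root r \<eta> v"
proof (cases "r * cos \<eta> < v")
  case True
  then show ?thesis using kepler_root_at_rest[OF sin, of 0 r v] by simp
next
  case False
  have "cos \<eta> = 1 \<or> cos \<eta> = -1"
    using sin_cos_squared_add[of \<eta>] sin by (simp add: power2_eq_1_iff)
  moreover have "r * (- 1) \<le> r * cos \<theta>" using r by (intro mult_left_mono) auto
  ultimately have cos: "cos \<eta> = 1" using False \<theta>(2) by auto
  then have "\<eta> < \<theta>" using False \<theta> \<open>\<eta> \<le> \<theta>\<close> by (cases "\<theta> = \<eta>") auto
  have "sin \<theta> = sin (\<theta> - \<eta>)" using sin cos by (simp add: sin_diff)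
  then have y: "\<theta> - \<eta> = r * sin (\<theta> - \<eta>)" using \<theta>(1) by (simp add: kepler_def)
  have "1 < r"
  proof (rule ccontr)
    assume "\<not> 1 < r"
    moreover have "0 < r * sin (\<theta> - \<eta>)" using y \<open>\<eta> < \<theta>\<close> by linarith
    then have "0 < sin (\<theta> - \<eta>)" using r by (simp add: zero_less_mult_iff)
    ultimately have "r * sin (\<theta> - \<eta>) \<le> sin (\<theta> - \<eta>)" by (simp add: mult_le_cancel_right1)
    then show False using y sin_less_self[of "\<theta> - \<eta>"] \<open>\<eta> < \<theta>\<close> by linarith
  qed
  show ?thesis
  proof (cases "ln r + 1 \<le> v")
    case True
    then show ?thesis using kepler_root_at_rest[OF sin, of "ln r" r v] \<open>1 < r\<close> cos
      by (simp add: exp_minus)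
  next
    case False
    have "eventually (\<lambda>t. kepler r t < kepler r \<eta>) (at_right \<eta>)"
      using \<open>1 < r\<close> cos by (intro eventually_less_at_right_if_deriv_neg[OF kepler_has_real_derivative]) simp
    then have below: "eventually (\<lambda>t. kepler r t < \<eta>) (at_right \<eta>)"
      using sin by (simp add: kepler_def)
    have "eventually (\<lambda>t. v < kepler_level r \<eta> t) (at_right \<eta>)"
      using tendsto_kepler_level_at_2pi[OF r sin cos] False by (intro order_tendstoD(1)) auto
    then have level: "eventually (\<lambda>t. v \<le> kepler_level r \<eta> t) (at_right \<eta>)"
      by (rule eventually_mono) simp
    show ?thesis using kepler_root_crossing_right[OF r below level \<open>\<eta> < \<theta>\<close> \<theta>] .
  qed
qed

theorem kepler_root_exists:
  assumes r: "0 < r" and a: "0 < a"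
  shows "kepler_root r (kepler r \<theta>) (r * cos \<theta> + a)"
proof -
  define \<eta> where "\<eta> = kepler r \<theta>"
  define v where "v = r * cos \<theta> + a"
  have fwd: "kepler r \<theta> = \<eta>" "r * cos \<theta> < v" using a by (auto simp: \<eta>_def v_def)
  then have bwd: "kepler r (- \<theta>) = - \<eta>" "r * cos (- \<theta>) < v" by (auto simp: kepler_minus)
  consider "0 < sin \<eta>" | "sin \<eta> < 0" | "sin \<eta> = 0" "\<eta> \<le> \<theta>" | "sin \<eta> = 0" "\<theta> < \<eta>"
    by linarith
  then have "kepler_root r \<eta> v"
  proof cases
    case 1
    then show ?thesis using kepler_root_sin_pos[OF r _ fwd] by blast
  next
    case 2
    then show ?thesis using kepler_root_sin_pos[OF r _ bwd] by (simp add: kepler_root_minus)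
  next
    case 3
    then show ?thesis using kepler_root_sin_zero[OF r _ _ fwd] by blast
  next
    case 4
    then show ?thesis using kepler_root_sin_zero[OF r _ _ bwd] by (simp add: kepler_root_minus)
  qed
  then show ?thesis by (simp add: \<eta>_def v_def)
qed

section \<open>The characteristic equation\<close>

lemma exp_equation_Re_pos_solution:
  fixes a :: real and b :: complex
  assumes a: "0 < a"
  shows "\<exists>u. 0 < Re u \<and> u = of_real a + b * (1 - exp (- u))"
proof (cases "b = 0")
  case True
  then show ?thesis using a by (intro exI[of _ "of_real a"]) auto
next
  case False
  define r where "r = cmod b"
  define \<phi> where "\<phi> = Arg b"
  have r: "0 < r" using False by (simp add: r_def)
  have b: "b = rcis r \<phi>" by (simp add: r_def \<phi>_def rcis_cmod_Arg)
  obtain x t where x: "0 < x" and t: "kepler (r * exp (- x)) t = kepler r (- \<phi>)"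
    and level: "x + r * exp (- x) * cos t = r * cos (- \<phi>) + a"
    using kepler_root_exists[OF r a, of "- \<phi>"] unfolding kepler_root_def by blast
  define u where "u = Complex x (t + \<phi>)"
  have "exp (- u) = rcis (exp (- x)) (- (t + \<phi>))"
    by (simp add: u_def exp_eq_polar rcis_def)
  then have "b * exp (- u) = rcis (r * exp (- x)) (- t)"
    by (simp add: b rcis_mult)
  then have "u = of_real a + b * (1 - exp (- u))"
    using t level by (intro complex_eqI) (auto simp: u_def b algebra_simps kepler_def)
  then show ?thesis using x by (intro exI[of _ u]) (simp add: u_def)
qed

lemma char_fun_rotmat:
  "char_fun (rotmat l w) (rotmat \<alpha> \<beta>) T z =
     (z - l - (1 - exp (- z * T)) * \<alpha>)\<^sup>2 + (w + (1 - exp (- z * T)) * \<beta>)\<^sup>2"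
  unfolding char_fun_def det_2 rotmat_def cmat_def
  by (simp add: matrix_matrix_mult_def mat_def sum_2 power2_eq_square algebra_simps)

lemma char_fun_rotmat_eq_0:
  assumes "z = l - \<i> * w + (1 - exp (- z * T)) * (\<alpha> - \<i> * \<beta>)"
  shows "char_fun (rotmat l w) (rotmat \<alpha> \<beta>) T z = 0"
proof -
  define c where "c = 1 - exp (- z * T)"
  have "z - l - c * \<alpha> = - \<i> * (w + c * \<beta>)"
    using assms unfolding c_def by (simp add: algebra_simps)
  then show ?thesis
    unfolding char_fun_rotmat c_def[symmetric] by (simp add: power_mult_distrib)
qed

theorem corollary6:
  fixes f :: "real^2 \<Rightarrow> real^2" and f' :: "real^2 \<Rightarrow> real^2^2"
    and xs :: "real^2" and lam \<omega> \<alpha> \<beta> :: real and n :: nat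
  assumes C1: "\<And>x. (f has_derivative (\<lambda>h. f' x *v h)) (at x)"
    and C1cont: "continuous_on UNIV f'"
    and equil: "f xs = 0"
    and jac: "f' xs = rotmat lam \<omega>"
    and lampos: "lam > 0" and om: "\<omega> > 0"
    and n: "n > 0"
  shows "\<exists>z. Re z > 0 \<and> char_fun (f' xs) (rotmat \<alpha> \<beta>) (2 * pi * real n / \<omega>) z = 0"
proof -
  \<comment> \<open>Only the Jacobian at \<open>xs\<close> enters \<open>char_fun\<close>.\<close>
  define T where "T = 2 * pi * real n / \<omega>"
  have T: "0 < T" using n om by (simp add: T_def)
  obtain u where u: "0 < Re u"
      "u = of_real (lam * T) + (of_real T * (of_real \<alpha> - \<i> * of_real \<beta>)) * (1 - exp (- u))"
    using exp_equation_Re_pos_solution[of "lam * T"] lampos T by auto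
  define z where "z = u / of_real T - \<i> * of_real \<omega>"
  have "- z * of_real T = - u + \<i> * (of_int (int n) * (of_real pi * 2))"
    using n om by (simp add: z_def T_def field_simps)
  then have "exp (- z * of_real T) = exp (- u)" by (simp only: exp_plus_2pin)
  then have "z = lam - \<i> * \<omega> + (1 - exp (- z * of_real T)) * (\<alpha> - \<i> * \<beta>)"
    using u(2) T by (simp add: z_def field_simps)
  then have "char_fun (f' xs) (rotmat \<alpha> \<beta>) T z = 0"
    unfolding jac by (rule char_fun_rotmat_eq_0)
  moreover have "0 < Re z" using u(1) T by (simp add: z_def)
  ultimately show ?thesis unfolding T_def by blast
qed

end
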